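(* Let $s$ be a real number with $0<s<1$. Then for every positive even integer $n$, $$2\left(n-\tfrac{1}{2}\right)^s < A_{n,s}^{-1} < 2\left(n-\tfrac{1}{4}\right)^s,$$ and for every positive odd integer $n$, $$-2\left(n-\tfrac{1}{4}\right)^s < B_{n,s}^{-1} < -2\left(n-\tfrac{1}{2}\right)^s.$$
   Context: For a positive integer $n$ and real $0<s<1$, define $A_{n,s} = \sum_{j=0}^{\infty}\left(\frac{1}{(n+2j)^s}-\frac{1}{(n+2j+1)^s}\right)$ and $B_{n,s} = \sum_{j=0}^{\infty}\left(-\frac{1}{(n+2j)^s}+\frac{1}{(n+2j+1)^s}\right)$. Here $A_{n,s}^{-1}$ denotes $1/A_{n,s}$ and similarly for $B$. *)

theory Defs
  imports "HOL-Analysis.Analysis" "HOL-Real_Asymp.Real_Asymp"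
begin

definition A :: "nat \<Rightarrow> real \<Rightarrow> real" where
  "A n s = (\<Sum>j. 1 / (real n + 2 * real j) powr s - 1 / (real n + 2 * real j + 1) powr s)"

definition B :: "nat \<Rightarrow> real \<Rightarrow> real" where
  "B n s = (\<Sum>j. - (1 / (real n + 2 * real j) powr s) + 1 / (real n + 2 * real j + 1) powr s)"

text \<open>The series converge, so the values of \<open>suminf\<close> above are genuine limits of partial sums.\<close>

lemma summable_A:
  fixes s :: real
  assumes "n > 0" "0 < s"
  shows "summable (\<lambda>j. 1 / (real n + 2 * real j) powr s - 1 / (real n + 2 * real j + 1) powr s)"
proof (rule summable_comparison_test')
  let ?f = "\<lambda>j. 1 / (real n + 2 * real j) powr s"
  have "?f \<longlonglongrightarrow> 0"
    using assms by real_asymp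
  then show "summable (\<lambda>j. ?f j - ?f (Suc j))"
    by (rule telescope_summable')
next
  fix j :: nat
  have le: "1 / y powr s \<le> 1 / x powr s" if "0 < x" "x \<le> y" for x y :: real
    using that assms by (intro divide_left_mono powr_mono2) auto
  have "1 / (real n + 2 * real j + 1) powr s \<le> 1 / (real n + 2 * real j) powr s"
    "1 / (real n + 2 * real (Suc j)) powr s \<le> 1 / (real n + 2 * real j + 1) powr s"
    using assms by (auto intro!: le)
  then show "norm (1 / (real n + 2 * real j) powr s - 1 / (real n + 2 * real j + 1) powr s)
      \<le> 1 / (real n + 2 * real j) powr s - 1 / (real n + 2 * real (Suc j)) powr s"
    by simp
qed

lemma summable_B:
  fixes s :: real
  assumes "n > 0" "0 < s"
  shows "summable (\<lambda>j. - (1 / (real n + 2 * real j) powr s) + 1 / (real n + 2 * real j + 1) powr s)"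
  using summable_minus[OF summable_A[OF assms]] by simp

end

theory Submission
  imports Defs
begin

text \<open>
  Since \<open>B n s = - A n s\<close>, it suffices to show
  \<open>1 / (2 (n - 1/4)\<^sup>s) < A n s < 1 / (2 (n - 1/2)\<^sup>s)\<close> for every \<open>n > 0\<close>. Both bounds are obtained
  term by term, comparing \<open>x\<^sup>-\<^sup>s - (x+1)\<^sup>-\<^sup>s\<close> with \<open>g(x) - g(x+2)\<close> for
  \<open>g(x) = (x - c)\<^sup>-\<^sup>s / 2\<close>. For \<open>c = 1/2\<close> this is convexity in \<open>y\<close> of
  \<open>(m-y)\<^sup>-\<^sup>s - (m+y)\<^sup>-\<^sup>s\<close> with \<open>m = x + 1/2\<close>. For \<open>c = 1/4\<close> the difference is, up to a factor,
  an exponential sum in \<open>s\<close> whose coefficients change sign three times; it vanishes at \<open>s = 0\<close>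
  with positive slope and is positive at \<open>s = 1\<close>, so by a Rolle argument it is positive in between.
\<close>

text \<open>If the difference \<open>\<psi>\<close> were nonpositive at \<open>s\<close>, its slope
  would be positive at 0, nonpositive somewhere before \<open>s\<close> and positive somewhere
  after. So \<open>h\<close>, which has the sign of \<open>\<psi>'\<close>, would first fall and
  then rise, whereas the sign of \<open>h'\<close> is that of the strictly decreasing
  \<open>\<theta>\<close>.\<close>

lemma exp_sum4_pos:
  fixes \<alpha> \<beta> \<gamma> s :: real
  assumes "\<alpha> < \<gamma>" "\<beta> < \<gamma>" "0 < \<gamma>"
    and slope0: "\<alpha> + \<gamma> / 2 < \<beta>"
    and at1: "1/2 + exp (- \<beta>) < exp (- \<alpha>) + exp (- \<gamma>) / 2"
    and s: "0 < s" "s < 1"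
  shows "1/2 + exp (- \<beta> * s) < exp (- \<alpha> * s) + exp (- \<gamma> * s) / 2"
proof (rule ccontr)
  define \<psi> where "\<psi> t = - 1/2 + exp (- \<alpha> * t) - exp (- \<beta> * t) + exp (- \<gamma> * t) / 2" for t
  define \<psi>' where
    "\<psi>' t = - \<alpha> * exp (- \<alpha> * t) + \<beta> * exp (- \<beta> * t) - \<gamma> * exp (- \<gamma> * t) / 2" for t
  \<comment> \<open>Multiplying \<open>\<psi>'\<close> by \<open>exp (\<alpha> * t)\<close> turns
    one of its three terms into a constant, which the next derivative removes.\<close>
  define h where "h t = - \<alpha> + \<beta> * exp ((\<alpha> - \<beta>) * t) - \<gamma> * exp ((\<alpha> - \<gamma>) * t) / 2" for t
  define h' where
    "h' t = \<beta> * (\<alpha> - \<beta>) * exp ((\<alpha> - \<beta>) * t) - \<gamma> * (\<alpha> - \<gamma>) * exp ((\<alpha> - \<gamma>) * t) / 2" for t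
  \<comment> \<open>The same device applied to \<open>h'\<close>: only a constant and one decaying
    exponential remain.\<close>
  define \<theta> where "\<theta> t = \<beta> * (\<alpha> - \<beta>) + \<gamma> * (\<gamma> - \<alpha>) / 2 * exp ((\<beta> - \<gamma>) * t)" for t
  have d\<psi>: "(\<psi> has_real_derivative \<psi>' t) (at t)" for t
    unfolding \<psi>_def \<psi>'_def by (auto intro!: derivative_eq_intros)
  have dh: "(h has_real_derivative h' t) (at t)" for t
    unfolding h_def h'_def by (auto intro!: derivative_eq_intros)
  have h: "h t = exp (\<alpha> * t) * \<psi>' t" for t
    unfolding h_def \<psi>'_def by (simp add: algebra_simps exp_diff exp_minus field_simps)
  have \<theta>: "h' t = exp ((\<alpha> - \<beta>) * t) * \<theta> t" for t
    unfolding h'_def \<theta>_def by (simp add: algebra_simps exp_diff exp_minus field_simps)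

  assume "\<not> 1/2 + exp (- \<beta> * s) < exp (- \<alpha> * s) + exp (- \<gamma> * s) / 2"
  then have "\<psi> s \<le> 0" by (simp add: \<psi>_def)
  have "\<psi> 0 = 0" "\<psi> 1 > 0" using at1 by (simp_all add: \<psi>_def)
  obtain t1 where t1: "0 < t1" "t1 < s" "\<psi> s - \<psi> 0 = (s - 0) * \<psi>' t1"
    using MVT2[OF s(1), of \<psi> \<psi>'] d\<psi> by blast
  obtain t2 where t2: "s < t2" "\<psi> 1 - \<psi> s = (1 - s) * \<psi>' t2"
    using MVT2[OF s(2), of \<psi> \<psi>'] d\<psi> by blast
  have "\<psi>' t1 \<le> 0"
    using t1(3) \<open>\<psi> s \<le> 0\<close> \<open>\<psi> 0 = 0\<close> s by (simp add: mult_le_0_iff)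
  then have c1: "h t1 \<le> 0" by (simp add: h mult_le_0_iff)
  have "0 < (1 - s) * \<psi>' t2"
    using t2(2) \<open>\<psi> s \<le> 0\<close> \<open>\<psi> 1 > 0\<close> by linarith
  then have c2: "h t2 > 0" using s by (simp add: h zero_less_mult_iff)
  have c0: "h 0 > 0" using slope0 by (simp add: h_def)
  have "t1 < t2" using t1 t2 by simp
  obtain u1 where u1: "0 < u1" "u1 < t1" "h t1 - h 0 = (t1 - 0) * h' u1"
    using MVT2[OF t1(1), of h h'] dh by blast
  obtain u2 where u2: "t1 < u2" "h t2 - h t1 = (t2 - t1) * h' u2"
    using MVT2[OF \<open>t1 < t2\<close>, of h h'] dh by blast
  have "t1 * h' u1 < 0" using u1(3) c0 c1 by simp
  then have "\<theta> u1 < 0" using t1 by (simp add: \<theta> mult_less_0_iff)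
  moreover have "0 < (t2 - t1) * h' u2" using u2(2) c1 c2 by linarith
  then have "\<theta> u2 > 0" using \<open>t1 < t2\<close> by (simp add: \<theta> zero_less_mult_iff)
  moreover have "exp ((\<beta> - \<gamma>) * u2) < exp ((\<beta> - \<gamma>) * u1)"
    using assms u1 u2 by (simp add: mult_less_cancel_left)
  then have "\<theta> u2 < \<theta> u1"
    using assms by (simp add: \<theta>_def)
  ultimately show False by linarith
qed

text \<open>Multiplying by \<open>a powr s\<close> with \<open>a = x - 1/4\<close> turns each power
  of \<open>y\<close> into \<open>exp (- ln (y / a) * s)\<close>, so \<open>exp_sum4_pos\<close>
  applies. Its conditions at 0 and at 1 become polynomial inequalities in \<open>x\<close>.\<close>

lemma powr_diff_lower:
  fixes x s :: real
  assumes x: "1 \<le> x" and s: "0 < s" "s < 1"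
  shows "(1 / (x - 1/4) powr s - 1 / (x + 7/4) powr s) / 2 < 1 / x powr s - 1 / (x + 1) powr s"
proof -
  define a where "a = x - 1/4"
  have a: "a > 0" using x by (simp add: a_def)
  have scale: "exp (- ln (y / a) * t) = a powr t * (1 / y powr t)" if "y > 0" for y t :: real
    using a that by (simp add: powr_def ln_div exp_minus field_simps flip: exp_add)
  have "1/2 + exp (- ln ((x + 1) / a) * s)
      < exp (- ln (x / a) * s) + exp (- ln ((x + 7/4) / a) * s) / 2"
  proof (rule exp_sum4_pos)
    show "ln (x / a) < ln ((x + 7/4) / a)" "ln ((x + 1) / a) < ln ((x + 7/4) / a)"
      using a x by (simp_all add: divide_strict_right_mono)
    show "0 < ln ((x + 7/4) / a)"
      using x by (simp add: a_def)
    \<comment> \<open>The slope condition, doubled and exponentiated, is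
      \<open>x\<^sup>2 * (x + 7/4) < (x + 1)\<^sup>2 * a\<close>.\<close>
    have "0 < x / 2 - 1/4" using x by simp
    also have "\<dots> = (x + 1)\<^sup>2 * a - x\<^sup>2 * (x + 7/4)"
      by (simp add: a_def power2_eq_square algebra_simps)
    finally have "ln (x\<^sup>2 * (x + 7/4)) < ln ((x + 1)\<^sup>2 * a)"
      using x a by simp
    then have "2 * ln x + ln (x + 7/4) < 2 * ln (x + 1) + ln a"
      using x a by (simp add: ln_mult ln_realpow)
    moreover have "ln (x / a) = ln x - ln a" "ln ((x + 1) / a) = ln (x + 1) - ln a"
      "ln ((x + 7/4) / a) = ln (x + 7/4) - ln a"
      using x a by (auto intro!: ln_divide_pos)
    ultimately show "ln (x / a) + ln ((x + 7/4) / a) / 2 < ln ((x + 1) / a)"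
      by linarith
    \<comment> \<open>At exponent 1 both differences of reciprocals have constant numerators, 2 and
      1, so comparing denominators suffices.\<close>
    have "0 < x / 2 - 7/16" using x by simp
    then have "x * (x + 1) < a * (x + 7/4)"
      by (simp add: a_def algebra_simps)
    then have "1 / (a * (x + 7/4)) < 1 / (x * (x + 1))"
      using x a by (intro divide_strict_left_mono) auto
    moreover have "1 / a - 1 / (x + 7/4) = 2 * (1 / (a * (x + 7/4)))"
      using x a by (simp add: a_def divide_simps)
    moreover have "1 / x - 1 / (x + 1) = 1 / (x * (x + 1))"
      using x by (simp add: divide_simps)
    ultimately have "1 / a - 1 / (x + 7/4) < 2 * (1 / x - 1 / (x + 1))" by simp
    from mult_strict_left_mono[OF this a]
    have "1 - a / (x + 7/4) < 2 * (a / x - a / (x + 1))"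
      using a by (simp add: algebra_simps)
    then have "1 - exp (- ln ((x + 7/4) / a)) < 2 * (exp (- ln (x / a)) - exp (- ln ((x + 1) / a)))"
      using x a by (simp add: exp_minus)
    then show "1/2 + exp (- ln ((x + 1) / a)) < exp (- ln (x / a)) + exp (- ln ((x + 7/4) / a)) / 2"
      by (smt (verit) field_sum_of_halves)
  qed (use s in auto)
  then have "a powr s * (1 / a powr s / 2 + 1 / (x + 1) powr s)
      < a powr s * (1 / x powr s + 1 / (x + 7/4) powr s / 2)"
    using x a by (simp only: scale) (simp add: algebra_simps)
  then have "1 / a powr s / 2 + 1 / (x + 1) powr s < 1 / x powr s + 1 / (x + 7/4) powr s / 2"
    by (rule mult_left_less_imp_less) simp
  then show ?thesis by (simp add: a_def)
qed

lemma powr_diff_upper: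
  fixes x s :: real
  assumes x: "1/2 < x" and s: "0 < s"
  shows "1 / x powr s - 1 / (x + 1) powr s < (1 / (x - 1/2) powr s - 1 / (x + 3/2) powr s) / 2"
proof -
  define m where "m = x + 1/2"
  have m: "1 < m" using x by (simp add: m_def)
  \<comment> \<open>The intervals from \<open>x\<close> to \<open>x + 1\<close> and from
    \<open>x - 1/2\<close> to \<open>x + 3/2\<close> share the midpoint \<open>m\<close>, so the
    claim reads \<open>D (1/2) < D 1 / 2\<close>.\<close>
  define D where "D y = (m - y) powr - s - (m + y) powr - s" for y
  define D' where "D' y = s * (m - y) powr (- s - 1) + s * (m + y) powr (- s - 1)" for y
  define D'' where
    "D'' y = s * (s + 1) * (m - y) powr (- s - 2) - s * (s + 1) * (m + y) powr (- s - 2)" for y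
  have dD: "(D has_real_derivative D' y) (at y)" if "0 \<le> y" "y \<le> 1" for y
    unfolding D_def D'_def using that m
    by (auto intro!: derivative_eq_intros simp: algebra_simps)
  have dD': "(D' has_real_derivative D'' y) (at y)" if "0 \<le> y" "y \<le> 1" for y
    unfolding D'_def D''_def using that m
    by (auto intro!: derivative_eq_intros simp: algebra_simps)
  \<comment> \<open>Since \<open>D 0 = 0\<close>, it is enough that the mean slope of
    \<open>D\<close> over the second half of the unit interval exceeds that over the first.\<close>
  obtain u where u: "0 < u" "u < 1/2" "D (1/2) - D 0 = (1/2 - 0) * D' u"
    using MVT2[of 0 "1/2" D D'] dD by auto
  obtain v where v: "1/2 < v" "v < 1" "D 1 - D (1/2) = (1 - 1/2) * D' v"
    using MVT2[of "1/2" 1 D D'] dD by auto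
  have "u < v" using u v by simp
  obtain w where w: "u < w" "w < v" "D' v - D' u = (v - u) * D'' w"
    using MVT2[OF \<open>u < v\<close>, of D' D''] dD' u v by auto
  have "(m + w) powr (- s - 2) < (m - w) powr (- s - 2)"
    using m s u v w by (intro powr_less_mono2_neg) auto
  then have "0 < D'' w" using s by (simp add: D''_def)
  then have "D' u < D' v" using w(3) \<open>u < v\<close>
    by (metis diff_gt_0_iff_gt mult_pos_pos)
  moreover have "D 0 = 0" by (simp add: D_def)
  ultimately have "D (1/2) < D 1 / 2" using u(3) v(3) by simp
  then show ?thesis
    by (simp add: D_def m_def powr_minus_divide add.commute)
qed

lemma suminf_strict_mono:
  fixes f g :: "nat \<Rightarrow> real"
  assumes "summable f" "summable g" "\<And>j. f j < g j"
  shows "suminf f < suminf g"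
  using suminf_pos[OF summable_diff[OF assms(2,1)]] suminf_diff[OF assms(2,1)] assms(3) by simp

text \<open>With \<open>c = n - 1/4\<close> and \<open>c = n - 1/2\<close> this evaluates the two
  series that bound \<open>A n s\<close> termwise.\<close>

lemma sums_telescope_powr:
  fixes c s :: real
  assumes "0 < s"
  shows "(\<lambda>j. (1 / (c + 2 * real j) powr s - 1 / (c + 2 + 2 * real j) powr s) / 2)
           sums (1 / (2 * c powr s))"
proof -
  define g where "g j = 1 / (c + 2 * real j) powr s / 2" for j
  have "g \<longlonglongrightarrow> 0"
    unfolding g_def using assms by real_asymp
  from telescope_sums'[OF this] show ?thesis
    by (simp add: g_def algebra_simps diff_divide_distrib)
qed

lemma A_bounds:
  fixes s :: real
  assumes n: "n > 0" and s: "0 < s" "s < 1"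
  shows "1 / (2 * (real n - 1/4) powr s) < A n s" "A n s < 1 / (2 * (real n - 1/2) powr s)"
proof -
  note tel = sums_telescope_powr[OF s(1)]
  show "1 / (2 * (real n - 1/4) powr s) < A n s"
    \<comment> \<open>The closed form is expanded back into its telescoping series, so that terms
      can be compared at \<open>x = n + 2 * j\<close>, which is at least 1.\<close>
    unfolding A_def sums_unique[OF tel]
  proof (rule suminf_strict_mono[OF sums_summable[OF tel] summable_A[OF n s(1)]])
    fix j
    show "(1 / (real n - 1/4 + 2 * real j) powr s - 1 / (real n - 1/4 + 2 + 2 * real j) powr s) / 2
        < 1 / (real n + 2 * real j) powr s - 1 / (real n + 2 * real j + 1) powr s"
      using powr_diff_lower[of "real n + 2 * real j" s] n s by (simp add: algebra_simps)
  qed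
  show "A n s < 1 / (2 * (real n - 1/2) powr s)"
    unfolding A_def sums_unique[OF tel]
  proof (rule suminf_strict_mono[OF summable_A[OF n s(1)] sums_summable[OF tel]])
    fix j
    show "1 / (real n + 2 * real j) powr s - 1 / (real n + 2 * real j + 1) powr s
        < (1 / (real n - 1/2 + 2 * real j) powr s - 1 / (real n - 1/2 + 2 + 2 * real j) powr s) / 2"
      using powr_diff_upper[of "real n + 2 * real j" s] n s by (simp add: algebra_simps)
  qed
qed

lemma inverse_A_bounds:
  fixes s :: real
  assumes n: "n > 0" and s: "0 < s" "s < 1"
  shows "2 * (real n - 1/2) powr s < inverse (A n s)" "inverse (A n s) < 2 * (real n - 1/4) powr s"
proof -
  have pos: "0 < 1 / (2 * (real n - 1/4) powr s)" using n by simp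
  also note A_bounds(1)[OF assms]
  finally have "0 < A n s" .
  from less_imp_inverse_less[OF A_bounds(2)[OF assms] this]
    less_imp_inverse_less[OF A_bounds(1)[OF assms] pos]
  show "2 * (real n - 1/2) powr s < inverse (A n s)"
    "inverse (A n s) < 2 * (real n - 1/4) powr s" by simp_all
qed

lemma B_eq_minus_A: "n > 0 \<Longrightarrow> 0 < s \<Longrightarrow> B n s = - A n s"
  unfolding A_def B_def by (simp add: summable_A flip: suminf_minus)

theorem theorem2p4:
  fixes s :: real
  assumes "0 < s" and "s < 1"
  shows "(\<forall>n::nat. n > 0 \<longrightarrow> even n \<longrightarrow>
            2 * (real n - 1/2) powr s < inverse (A n s) \<and>
            inverse (A n s) < 2 * (real n - 1/4) powr s) \<and>
         (\<forall>n::nat. n > 0 \<longrightarrow> odd n \<longrightarrow>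
            - 2 * (real n - 1/4) powr s < inverse (B n s) \<and>
            inverse (B n s) < - 2 * (real n - 1/2) powr s)"
  using inverse_A_bounds[OF _ assms] B_eq_minus_A[OF _ assms(1)] by simp

end
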